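(* Let $f(x)=\dfrac{1+x}{(1-x^{2})^{s/2}}=\sum_{k\ge0}a_kx^k/k!$, so that $a_{2k}=\dfrac{(2k)!}{k!}\,(s/2)_k$ and $a_{2k+1}=(2k+1)a_{2k}$, where $s$ is a parameter. Then for all $n\ge1$, $$\ddot H_n(f)=\det(a_{2i+j})_{0\le i,j\le n-1}=\Bigl(\prod_{k=1}^{n-1}(2k)!\Bigr)\prod_{j=1}^{n-1}\bigl(s+2j-2\bigr)^{\,n-j} =2^{\binom n2}\prod_{k=1}^{n-1}(2k)!\prod_{i=1}^{n-1}(s/2)_i .$$
   Context: $(\gamma)_m=\gamma(\gamma+1)\cdots(\gamma+m-1)$ is the Pochhammer symbol; empty products equal $1$. *)

theory Defs
  imports
    "HOL-Computational_Algebra.Formal_Power_Series"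
    "Jordan_Normal_Form.Determinant"
begin

(* a_k in the expansion F(x) = sum over k of a_k x^k / k! *)
definition egf_coeff :: "'a :: field_char_0 fps \<Rightarrow> nat \<Rightarrow> 'a"
  where "egf_coeff F k = fact k * fps_nth F k"

definition ddot_hankel :: "nat \<Rightarrow> 'a :: field_char_0 fps \<Rightarrow> 'a"
  where "ddot_hankel n F = det (mat n n (\<lambda>(i, j). egf_coeff F (2 * i + j)))"

(* fps_binomial c is the binomial series (1 + x)^c; composing it with -x^2
   gives (1 - x^2)^c.  Its constant coefficient is 1, so it is invertible and
   the division is the genuine one. *)
definition f_series :: "'a :: field_char_0 \<Rightarrow> 'a fps"
  where "f_series s = (1 + fps_X) / (fps_binomial (s / 2) oo (- (fps_X ^ 2)))"

end

theory Submission
  imports Defs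
begin

text \<open>
  Consecutive coefficients satisfy \<open>a\<^bsub>k+1\<^esub> = (k + \<beta>\<^sub>k) a\<^sub>k\<close> with \<open>\<beta>\<^sub>k\<close> depending only on
  the parity of \<open>k\<close>. Hence \<open>a\<^bsub>2i+j\<^esub> = a\<^bsub>2i\<^esub> p\<^sub>j(i)\<close>, where \<open>p\<^sub>j\<close> is a polynomial of degree
  \<open>j\<close> with leading coefficient \<open>2\<^sup>j\<close>. Expanding \<open>p\<^sub>j(i)\<close> in the binomials \<open>i choose k\<close>
  factors the matrix into a lower triangular one with diagonal entries \<open>a\<^bsub>2i\<^esub>\<close> and an upper
  triangular one with diagonal entries \<open>2\<^sup>j j!\<close>.
\<close>

text \<open>
  The coefficients of \<open>\<Prod>l<j. (\<alpha> * x + \<gamma> l)\<close> in the basis \<open>x choose k\<close>; the recursion is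
  \<open>x * (x choose k) = k * (x choose k) + (k + 1) * (x choose (k + 1))\<close>.
\<close>

fun newton_coeff :: "'a :: comm_ring_1 \<Rightarrow> (nat \<Rightarrow> 'a) \<Rightarrow> nat \<Rightarrow> nat \<Rightarrow> 'a" where
  "newton_coeff \<alpha> \<gamma> 0 k = (if k = 0 then 1 else 0)"
| "newton_coeff \<alpha> \<gamma> (Suc j) 0 = \<gamma> j * newton_coeff \<alpha> \<gamma> j 0"
| "newton_coeff \<alpha> \<gamma> (Suc j) (Suc k) =
     \<alpha> * of_nat (Suc k) * newton_coeff \<alpha> \<gamma> j k
     + (\<alpha> * of_nat (Suc k) + \<gamma> j) * newton_coeff \<alpha> \<gamma> j (Suc k)"

lemma newton_coeff_eq_0: "j < k \<Longrightarrow> newton_coeff \<alpha> \<gamma> j k = 0"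
  by (induction \<alpha> \<gamma> j k rule: newton_coeff.induct) auto

lemma newton_coeff_diag: "newton_coeff \<alpha> \<gamma> j j = \<alpha> ^ j * fact j"
  by (induction j) (simp_all add: newton_coeff_eq_0 algebra_simps)

text \<open>Shifting the index in the part of the recursion that comes from \<open>k - 1\<close>
  produces \<open>i choose Suc k\<close>, which absorption turns into a multiple of
  \<open>i choose k\<close>. The factors then add up: \<alpha> (i - k) + (\<alpha> k + \<gamma> j) =
  \<alpha> i + \<gamma> j.\<close>

lemma sum_newton_coeff_Suc:
  "(\<Sum>k\<le>i. newton_coeff \<alpha> \<gamma> (Suc j) k * of_nat (i choose k)) =
   (\<alpha> * of_nat i + \<gamma> j) * (\<Sum>k\<le>i. newton_coeff \<alpha> \<gamma> j k * of_nat (i choose k))"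
proof -
  let ?c = "newton_coeff \<alpha> \<gamma> j"
  have absorb: "of_nat (Suc k) * of_nat (i choose Suc k) =
      (of_nat i - of_nat k :: 'a) * of_nat (i choose k)" if "k \<le> i" for k
  proof -
    have "Suc k * (i choose Suc k) = (i - k) * (i choose k)"
      by (metis binomial_absorption binomial_absorb_comp)
    then show ?thesis
      using that by (metis of_nat_diff of_nat_mult)
  qed
  have "newton_coeff \<alpha> \<gamma> (Suc j) k =
      (case k of 0 \<Rightarrow> 0 | Suc l \<Rightarrow> \<alpha> * of_nat (Suc l) * ?c l) + (\<alpha> * of_nat k + \<gamma> j) * ?c k" for k
    by (cases k) auto
  then have "(\<Sum>k\<le>i. newton_coeff \<alpha> \<gamma> (Suc j) k * of_nat (i choose k)) =
      (\<Sum>k\<le>i. (case k of 0 \<Rightarrow> 0 | Suc l \<Rightarrow> \<alpha> * of_nat (Suc l) * ?c l) * of_nat (i choose k))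
      + (\<Sum>k\<le>i. (\<alpha> * of_nat k + \<gamma> j) * ?c k * of_nat (i choose k))"
    by (simp add: distrib_right sum.distrib)
  \<comment> \<open>The added term vanishes since \<open>i choose Suc i\<close> is 0; with it, the
    index shift ends at \<open>i\<close> again.\<close>
  also have "(\<Sum>k\<le>i. (case k of 0 \<Rightarrow> 0 | Suc l \<Rightarrow> \<alpha> * of_nat (Suc l) * ?c l) * of_nat (i choose k)) =
      (\<Sum>k\<le>Suc i. (case k of 0 \<Rightarrow> 0 | Suc l \<Rightarrow> \<alpha> * of_nat (Suc l) * ?c l) * of_nat (i choose k))"
    by (simp add: binomial_eq_0)
  also have "\<dots> = (\<Sum>k\<le>i. \<alpha> * of_nat (Suc k) * ?c k * of_nat (i choose Suc k))"
    by (subst sum.atMost_Suc_shift) simp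
  also have "\<dots> = (\<Sum>k\<le>i. \<alpha> * (of_nat i - of_nat k) * ?c k * of_nat (i choose k))"
  proof (rule sum.cong[OF refl])
    fix k assume "k \<in> {..i}"
    then have *: "of_nat (Suc k) * of_nat (i choose Suc k) =
      (of_nat i - of_nat k :: 'a) * of_nat (i choose k)" by (intro absorb) simp
    have "\<alpha> * of_nat (Suc k) * ?c k * of_nat (i choose Suc k) =
      \<alpha> * ?c k * (of_nat (Suc k) * of_nat (i choose Suc k))" by (simp only: ac_simps)
    also have "\<dots> = \<alpha> * (of_nat i - of_nat k) * ?c k * of_nat (i choose k)"
      unfolding * by (simp only: ac_simps)
    finally show "\<alpha> * of_nat (Suc k) * ?c k * of_nat (i choose Suc k) =
      \<alpha> * (of_nat i - of_nat k) * ?c k * of_nat (i choose k)" .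
  qed
  finally show ?thesis
    by (simp add: sum_distrib_left algebra_simps flip: sum.distrib)
qed

lemma sum_newton_coeff:
  fixes A :: "nat \<Rightarrow> 'a :: comm_ring_1"
  assumes "\<And>j. A (Suc j) = (\<alpha> * of_nat i + \<gamma> j) * A j"
  shows "A j = A 0 * (\<Sum>k\<le>i. newton_coeff \<alpha> \<gamma> j k * of_nat (i choose k))"
proof (induction j)
  case 0
  have "(\<Sum>k\<le>i. newton_coeff \<alpha> \<gamma> 0 k * of_nat (i choose k)) = (1 :: 'a)"
    by (subst sum.atMost_shift) simp
  then show ?case by simp
next
  case (Suc j)
  show ?case
    unfolding assms[of j] sum_newton_coeff_Suc by (subst Suc) (simp only: ac_simps)
qed

text \<open>Since \<gamma> depends on the column only, the Newton coefficients are the same in every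
  row, so they can form the right factor of a matrix product.\<close>

lemma det_affine_ratio:
  fixes A :: "nat \<Rightarrow> nat \<Rightarrow> 'a :: {idom, semiring_char_0}"
  assumes "\<And>i j. A i (Suc j) = (\<alpha> * of_nat i + \<gamma> j) * A i j"
  shows "det (mat n n (\<lambda>(i, j). A i j)) = (\<Prod>i<n. A i 0) * (\<Prod>j<n. \<alpha> ^ j * fact j)"
proof -
  let ?L = "mat n n (\<lambda>(i, k). A i 0 * of_nat (i choose k))"
  let ?U = "mat n n (\<lambda>(k, j). newton_coeff \<alpha> \<gamma> j k)"
  have "mat n n (\<lambda>(i, j). A i j) = ?L * ?U"
  proof (rule eq_matI)
    fix i j assume "i < dim_row (?L * ?U)" "j < dim_col (?L * ?U)"
    then have i: "i < n" and j: "j < n" by auto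
    have "A i j = A i 0 * (\<Sum>k\<le>i. newton_coeff \<alpha> \<gamma> j k * of_nat (i choose k))"
      by (rule sum_newton_coeff) (rule assms)
    \<comment> \<open>The terms with i < k < n vanish because \<open>i choose k\<close> does; the
      new range no longer depends on the row.\<close>
    also have "(\<Sum>k\<le>i. newton_coeff \<alpha> \<gamma> j k * of_nat (i choose k)) =
        (\<Sum>k = 0..<n. newton_coeff \<alpha> \<gamma> j k * of_nat (i choose k))"
      using i by (intro sum.mono_neutral_left) auto
    also have "A i 0 * \<dots> = (?L * ?U) $$ (i, j)"
      using i j by (simp add: scalar_prod_def sum_distrib_left ac_simps)
    finally show "mat n n (\<lambda>(i, j). A i j) $$ (i, j) = (?L * ?U) $$ (i, j)"
      using i j by simp
  qed auto
  then have "det (mat n n (\<lambda>(i, j). A i j)) = det ?L * det ?U"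
    by (simp add: det_mult[of _ n])
  also have "det ?L = (\<Prod>i<n. A i 0)"
    by (subst det_lower_triangular[of n]) (auto simp: prod_list_diag_prod atLeast0LessThan)
  also have "det ?U = (\<Prod>j<n. \<alpha> ^ j * fact j)"
    by (subst det_upper_triangular[of _ n])
      (auto simp: upper_triangular_def newton_coeff_eq_0 prod_list_diag_prod newton_coeff_diag
        atLeast0LessThan)
  finally show ?thesis .
qed

lemma fps_nth_compose_uminus_X2:
  fixes F :: "'a :: comm_ring_1 fps"
  shows "fps_nth (F oo (- (fps_X ^ 2))) (2 * k) = (-1) ^ k * fps_nth F k"
    and "fps_nth (F oo (- (fps_X ^ 2))) (Suc (2 * k)) = 0"
proof -
  have pw: "(- (fps_X ^ 2)) ^ i = fps_const ((-1) ^ i :: 'a) * fps_X ^ (2 * i)" for i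
    by (simp add: power_minus[of "fps_X ^ 2"] power_mult fps_const_power[symmetric] flip: fps_const_neg)
  show "fps_nth (F oo (- (fps_X ^ 2))) (2 * k) = (-1) ^ k * fps_nth F k"
    unfolding fps_compose_nth pw
    by (subst sum.remove[of _ k]) (auto intro!: sum.neutral simp: fps_X_power_nth)
  show "fps_nth (F oo (- (fps_X ^ 2))) (Suc (2 * k)) = 0"
    unfolding fps_compose_nth pw
    by (rule sum.neutral) (auto simp: fps_X_power_nth Suc_double_not_eq_double)
qed

lemma inverse_fps_binomial: "inverse (fps_binomial c) = fps_binomial (- c)"
proof -
  have "fps_binomial c * fps_binomial (- c) = 1"
    by (simp flip: fps_binomial_add_mult)
  then show ?thesis
    by (rule fps_inverse_unique)
qed

text \<open>The divisor has constant coefficient 1, so division is multiplication by the inverse,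
  and inverting commutes with the composition.\<close>

lemma f_series_eq: "f_series s = (1 + fps_X) * (fps_binomial (- (s / 2)) oo (- (fps_X ^ 2)))"
proof -
  have "fps_nth (fps_binomial (s / 2) oo (- (fps_X ^ 2))) 0 = 1"
    by simp
  then show ?thesis
    unfolding f_series_def
    by (simp add: fps_divide_unit fps_inverse_compose[symmetric] inverse_fps_binomial)
qed

lemma egf_coeff_f_series_even:
  "egf_coeff (f_series s) (2 * k) = fact (2 * k) / fact k * pochhammer (s / 2) k"
  (is ?E)
  and egf_coeff_f_series_odd:
  "egf_coeff (f_series s) (2 * k + 1) = of_nat (2 * k + 1) * egf_coeff (f_series s) (2 * k)"
proof -
  let ?G = "fps_binomial (- (s / 2)) oo (- (fps_X ^ 2))"
  \<comment> \<open>The sign from substituting -x^2 cancels the sign in the generalized binomial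
    coefficient of a negated argument.\<close>
  have G: "fps_nth ?G (2 * k) = pochhammer (s / 2) k / fact k"
    by (simp add: fps_nth_compose_uminus_X2 gbinomial_pochhammer flip: power_mult_distrib mult.assoc)
  \<comment> \<open>\<open>?G\<close> has no odd coefficients, so multiplying by 1 + x keeps each
    even one and copies it to the next odd place.\<close>
  have E: "fps_nth (f_series s) (2 * k) = fps_nth ?G (2 * k)"
    unfolding f_series_eq
    by (cases k) (simp_all add: distrib_right fps_nth_compose_uminus_X2(2) del: fps_compose_nth)
  have O: "fps_nth (f_series s) (Suc (2 * k)) = fps_nth ?G (2 * k)"
    unfolding f_series_eq
    by (simp add: distrib_right fps_nth_compose_uminus_X2(2))
  show ?E
    by (simp add: egf_coeff_def E G)
  show "egf_coeff (f_series s) (2 * k + 1) = of_nat (2 * k + 1) * egf_coeff (f_series s) (2 * k)"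
    by (simp add: egf_coeff_def E O)
qed

lemma egf_coeff_f_series_Suc:
  "egf_coeff (f_series s) (Suc k) =
   (of_nat k + (if even k then 1 else s - 1)) * egf_coeff (f_series s) k"
proof (cases "even k")
  case True
  then obtain r where "k = 2 * r" by (elim evenE)
  then show ?thesis using egf_coeff_f_series_odd[of s r] by (simp add: add.commute)
next
  case False
  then obtain r where k: "k = 2 * r + 1" by (elim oddE)
  have Suc_k: "Suc k = 2 * Suc r" using k by simp
  have "1 + of_nat r \<noteq> (0 :: 'a)"
    using of_nat_neq_0[of r] by simp
  \<comment> \<open>With the new Pochhammer factor s/2 + r this gives the ratio (2r + 1)(2r + s)
    over two steps. The odd coefficient already carries 2r + 1, which leaves 2r + s = k + s -
    1.\<close>
  then have quot: "fact (2 * Suc r) / fact (Suc r) = 2 * of_nat (2 * r + 1) * (fact (2 * r) / fact r :: 'a)"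
    by (simp add: divide_simps) (simp add: algebra_simps)
  show ?thesis
    unfolding Suc_k egf_coeff_f_series_even quot pochhammer_Suc
    unfolding k egf_coeff_f_series_odd egf_coeff_f_series_even
    by (simp add: algebra_simps add_divide_distrib)
qed

text \<open>The factor s + 2j - 2 = 2 (s/2 + j - 1) occurs, up to the 2, once in each
  \<open>pochhammer (s / 2) i\<close> with j \<le> i \<le> m.\<close>

lemma prod_pochhammer:
  fixes s :: "'a :: field_char_0"
  shows "(\<Prod>j = 1..m. (s + 2 * of_nat j - 2) ^ (Suc m - j)) =
    2 ^ (Suc m choose 2) * (\<Prod>i = 1..m. pochhammer (s / 2) i)"
proof (induction m)
  case (Suc m)
  have single: "(\<Prod>j = 1..m'. s + 2 * of_nat j - 2) = 2 ^ m' * pochhammer (s / 2) m'" for m'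
    by (induction m') (simp_all add: pochhammer_Suc algebra_simps)
  have "(\<Prod>j = 1..Suc m. (s + 2 * of_nat j - 2) ^ (Suc (Suc m) - j)) =
     (\<Prod>j = 1..Suc m. (s + 2 * of_nat j - 2) * (s + 2 * of_nat j - 2) ^ (Suc m - j))"
    by (intro prod.cong) (auto simp: Suc_diff_le)
  also have "\<dots> = (\<Prod>j = 1..Suc m. s + 2 * of_nat j - 2) *
      (\<Prod>j = 1..m. (s + 2 * of_nat j - 2) ^ (Suc m - j))"
    by (subst prod.distrib) simp
  finally show ?case
    unfolding single Suc.IH by (simp add: numeral_2_eq_2 power_add ac_simps)
qed (simp add: numeral_2_eq_2)

lemma ddot_hankel_f_series:
  "ddot_hankel (Suc m) (f_series s) =
     2 ^ (Suc m choose 2) * (\<Prod>k = 1..m. fact (2 * k)) * (\<Prod>i = 1..m. pochhammer (s / 2) i)"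
proof -
  let ?a = "egf_coeff (f_series s)"
  \<comment> \<open>The parity of \<open>2 * i + j\<close> is that of \<open>j\<close>, so the
    summand in parentheses depends on the column only.\<close>
  have ratio: "?a (2 * i + Suc j) =
      (2 * of_nat i + (of_nat j + (if even j then 1 else s - 1))) * ?a (2 * i + j)" for i j
    using egf_coeff_f_series_Suc[of s "2 * i + j"] by (simp add: add.assoc)
  have "ddot_hankel (Suc m) (f_series s) =
      (\<Prod>i<Suc m. ?a (2 * i + 0)) * (\<Prod>j<Suc m. 2 ^ j * fact j)"
    unfolding ddot_hankel_def by (rule det_affine_ratio) (rule ratio)
  \<comment> \<open>The factorials of the second product cancel the denominators
    \<open>fact i\<close> of the even coefficients.\<close>
  also have "\<dots> = (\<Prod>i<Suc m. 2 ^ i * fact (2 * i) * pochhammer (s / 2) i)"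
    unfolding prod.distrib[symmetric]
    by (intro prod.cong) (simp_all add: egf_coeff_f_series_even)
  also have "\<dots> = 2 ^ (Suc m choose 2) * (\<Prod>k = 1..m. fact (2 * k)) *
      (\<Prod>i = 1..m. pochhammer (s / 2) i)"
    by (induction m) (simp_all add: numeral_2_eq_2 power_add ac_simps)
  finally show ?thesis .
qed

theorem theorem20p1:
  fixes s :: "'a :: field_char_0"
  shows "(\<forall>k. egf_coeff (f_series s) (2 * k) = fact (2 * k) / fact k * pochhammer (s / 2) k) \<and>
    (\<forall>k. egf_coeff (f_series s) (2 * k + 1) = of_nat (2 * k + 1) * egf_coeff (f_series s) (2 * k)) \<and>
    (\<forall>n\<ge>1.
      ddot_hankel n (f_series s) =
        (\<Prod>k = 1..n - 1. fact (2 * k)) *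
        (\<Prod>j = 1..n - 1. (s + 2 * of_nat j - 2) ^ (n - j)) \<and>
      (\<Prod>k = 1..n - 1. fact (2 * k)) *
        (\<Prod>j = 1..n - 1. (s + 2 * of_nat j - 2) ^ (n - j)) =
      2 ^ (n choose 2) * (\<Prod>k = 1..n - 1. fact (2 * k)) *
        (\<Prod>i = 1..n - 1. pochhammer (s / 2) i))"
proof (intro conjI allI impI)
  fix n :: nat
  assume "n \<ge> 1"
  then obtain m where n: "n = Suc m" by (cases n) auto
  show eq: "(\<Prod>k = 1..n - 1. fact (2 * k)) *
        (\<Prod>j = 1..n - 1. (s + 2 * of_nat j - 2) ^ (n - j)) =
      2 ^ (n choose 2) * (\<Prod>k = 1..n - 1. fact (2 * k)) *
        (\<Prod>i = 1..n - 1. pochhammer (s / 2) i)"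
    unfolding n diff_Suc_1 prod_pochhammer by (simp only: ac_simps)
  show "ddot_hankel n (f_series s) = (\<Prod>k = 1..n - 1. fact (2 * k)) *
        (\<Prod>j = 1..n - 1. (s + 2 * of_nat j - 2) ^ (n - j))"
    unfolding eq unfolding n diff_Suc_1 by (rule ddot_hankel_f_series)
qed (rule egf_coeff_f_series_even egf_coeff_f_series_odd)+

end
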